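(* Let $F_\varepsilon:\Sigma^*\to\mathbb{C}$, $\varepsilon\in(0,1]$, be a family of functionals, and let $N_0(\varepsilon)=\lfloor\log_2(1/\varepsilon)\rfloor$. (i) If $F_\varepsilon(u)$ depends only on the prefix $u[1\ldots N_0(\varepsilon)]$ and, for every moderate net $(w_\varepsilon)$, the net $(F_\varepsilon(w_\varepsilon))$ belongs to $\mathcal{E}_M(\mathbb{C})$, then the assignment $[(w_\varepsilon)]\mapsto[(F_\varepsilon(w_\varepsilon))]$ is well defined on $\widetilde{\Sigma}^*$ (with values in $\widetilde{\mathbb{C}}$). (ii) If $F_\varepsilon$ depends on a window of length $L(\varepsilon)$ with $L(\varepsilon)/\log_2(1/\varepsilon)\to\infty$, then in general it is not well defined on $\widetilde{\Sigma}^*$; its value must be attached to a particular representative rather than to the equivalence class.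
   Context: $\Sigma$ is a finite non-empty alphabet; $\Sigma^*$ is the free monoid of finite words over $\Sigma$ (including the empty word) under concatenation, and $|w|$ is the length of $w$. For $n\in\mathbb{N}$, $w[1\ldots n]$ is the prefix of $w$ of length $n$, with $w[1\ldots n]:=w$ if $n>|w|$. The window of length $n$ of a word $w$ is the prefix $w[1\ldots n]$; the case $n=N_0(\varepsilon)$ is the logarithmic window. For $u\neq v$ in $\Sigma^*$, $\operatorname{lcp}(u,v)$ and $\operatorname{lcs}(u,v)$ are the lengths of the longest common prefix and of the longest common suffix of $u,v$; by convention $\operatorname{lcp}(u,u)=\operatorname{lcs}(u,u)=+\infty$. A net of words is a family $(w_\varepsilon)_{\varepsilon\in(0,1]}$ of words in $\Sigma^*$. It is moderate if there exist $N\in\mathbb{N}$, $C>0$, $\varepsilon_0>0$ with $|w_\varepsilon|\le C\varepsilon^{-N}$ for all $\varepsilon<\varepsilon_0$; $\mathcal{E}_M(\Sigma^* )$ is the set of moderate nets. Two moderate nets are equivalent, $(u_\varepsilon)\sim(v_\varepsilon)$, if for every $m\in\mathbb{N}$ there exists $\varepsilon_0>0$ such that $\min\{\operatorname{lcp}(u_\varepsilon,v_\varepsilon),\operatorname{lcs}(u_\varepsilon,v_\varepsilon)\}\ge m\log_2(1/\varepsilon)$ for all $\varepsilon<\varepsilon_0$; this is an equivalence relation. $\widetilde{\Sigma}^*:=\mathcal{E}_M(\Sigma^* )/\sim$, and $[(w_\varepsilon)]$ denotes the class of $(w_\varepsilon)$. Generalized complex numbers: $\mathcal{E}_M(\mathbb{C})$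 is the set of families $(z_\varepsilon)_{\varepsilon\in(0,1]}$ in $\mathbb{C}$ for which there are $N,C>0$ with $|z_\varepsilon|\le C\varepsilon^{-N}$ for all sufficiently small $\varepsilon$; $\mathcal{N}(\mathbb{C})$ is the set of families such that for every $m$ there is $C_m>0$ with $|z_\varepsilon|\le C_m\varepsilon^m$ for all sufficiently small $\varepsilon$; $\widetilde{\mathbb{C}}:=\mathcal{E}_M(\mathbb{C})/\mathcal{N}(\mathbb{C})$, with classes written $[(z_\varepsilon)]$. *)

theory Defs
  imports "HOL-Analysis.Analysis" "HOL-Library.Sublist"
begin

text \<open>
  The alphabet is a type of class \<open>finite\<close>. Families indexed by \<open>(0,1]\<close> are extensional
  functions on \<open>{0<..1}\<close>. Statements of the form ``there is \<open>\<epsilon>\<^sub>0 > 0\<close> such that for all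
  \<open>\<epsilon> < \<epsilon>\<^sub>0\<close>'' are expressed by the filter \<open>at_right 0\<close>, which only sees arbitrarily small
  positive indices.
\<close>

abbreviation nets :: "(real \<Rightarrow> 'b) set" where
  "nets \<equiv> {0<..1} \<rightarrow>\<^sub>E UNIV"

definition lcp :: "'a list \<Rightarrow> 'a list \<Rightarrow> ereal" where
  "lcp u v = (if u = v then \<infinity> else ereal (real (length (longest_common_prefix u v))))"

text \<open>The common suffixes of two words are the reversals of the common prefixes of their reversals.\<close>

definition lcs :: "'a list \<Rightarrow> 'a list \<Rightarrow> ereal" where
  "lcs u v = lcp (rev u) (rev v)"

definition moderate_words :: "(real \<Rightarrow> 'a::finite list) set" where
  "moderate_words = {w \<in> nets. \<exists>(N::nat) C. C > 0 \<and>
     (\<forall>\<^sub>F \<epsilon> in at_right 0. real (length (w \<epsilon>)) \<le> C * \<epsilon> powr (- real N))}"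

definition word_equiv :: "((real \<Rightarrow> 'a::finite list) \<times> (real \<Rightarrow> 'a list)) set" where
  "word_equiv = {(u, v). u \<in> moderate_words \<and> v \<in> moderate_words \<and>
     (\<forall>m::nat. \<forall>\<^sub>F \<epsilon> in at_right 0.
        min (lcp (u \<epsilon>) (v \<epsilon>)) (lcs (u \<epsilon>) (v \<epsilon>)) \<ge> ereal (real m * log 2 (1 / \<epsilon>)))}"

definition gen_words :: "(real \<Rightarrow> 'a::finite list) set set" where
  "gen_words = moderate_words // word_equiv"

definition word_class :: "(real \<Rightarrow> 'a::finite list) \<Rightarrow> (real \<Rightarrow> 'a list) set" where
  "word_class w = word_equiv `` {w}"

definition moderate_complex :: "(real \<Rightarrow> complex) set" where
  "moderate_complex = {z \<in> nets. \<exists>(N::nat) C. N > 0 \<and> C > 0 \<and>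
     (\<forall>\<^sub>F \<epsilon> in at_right 0. cmod (z \<epsilon>) \<le> C * \<epsilon> powr (- real N))}"

definition negligible_complex :: "(real \<Rightarrow> complex) set" where
  "negligible_complex = {z \<in> nets. \<forall>m::nat. \<exists>C>0.
     \<forall>\<^sub>F \<epsilon> in at_right 0. cmod (z \<epsilon>) \<le> C * \<epsilon> ^ m}"

definition complex_equiv :: "((real \<Rightarrow> complex) \<times> (real \<Rightarrow> complex)) set" where
  "complex_equiv = {(z, z'). z \<in> moderate_complex \<and> z' \<in> moderate_complex \<and>
     (\<lambda>\<epsilon>\<in>{0<..1}. z \<epsilon> - z' \<epsilon>) \<in> negligible_complex}"

definition gen_complex :: "(real \<Rightarrow> complex) set set" where
  "gen_complex = moderate_complex // complex_equiv"

definition complex_class :: "(real \<Rightarrow> complex) \<Rightarrow> (real \<Rightarrow> complex) set" where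
  "complex_class z = complex_equiv `` {z}"

definition log_window :: "real \<Rightarrow> nat" where
  "log_window \<epsilon> = nat \<lfloor>log 2 (1 / \<epsilon>)\<rfloor>"

text \<open>The prefix \<open>w[1\<dots>n]\<close> is \<open>take n w\<close>, which is \<open>w\<close> itself when \<open>n > length w\<close>.\<close>

definition depends_on_window :: "(real \<Rightarrow> 'a list \<Rightarrow> complex) \<Rightarrow> (real \<Rightarrow> nat) \<Rightarrow> bool" where
  "depends_on_window F L \<longleftrightarrow>
     (\<forall>\<epsilon>\<in>{0<..1}. \<forall>u v. take (L \<epsilon>) u = take (L \<epsilon>) v \<longrightarrow> F \<epsilon> u = F \<epsilon> v)"

definition apply_net ::
    "(real \<Rightarrow> 'a list \<Rightarrow> complex) \<Rightarrow> (real \<Rightarrow> 'a list) \<Rightarrow> real \<Rightarrow> complex" where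
  "apply_net F w = (\<lambda>\<epsilon>\<in>{0<..1}. F \<epsilon> (w \<epsilon>))"

definition preserves_moderate :: "(real \<Rightarrow> 'a::finite list \<Rightarrow> complex) \<Rightarrow> bool" where
  "preserves_moderate F \<longleftrightarrow> (\<forall>w\<in>moderate_words. apply_net F w \<in> moderate_complex)"

definition well_defined_on_gen_words :: "(real \<Rightarrow> 'a::finite list \<Rightarrow> complex) \<Rightarrow> bool" where
  "well_defined_on_gen_words F \<longleftrightarrow>
     (\<exists>\<Phi> \<in> gen_words \<rightarrow> gen_complex.
        \<forall>w\<in>moderate_words. \<Phi> (word_class w) = complex_class (apply_net F w))"

lemma lcp_trans:
  assumes "ereal c \<le> lcp u v" "ereal c \<le> lcp v w"
  shows "ereal c \<le> lcp u w"
proof (cases "u = v \<or> v = w \<or> u = w")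
  case True
  then show ?thesis using assms by (auto simp: lcp_def)
next
  case False
  let ?p = "longest_common_prefix u v" and ?q = "longest_common_prefix v w"
  have p: "prefix ?p u" "prefix ?p v" and q: "prefix ?q v" "prefix ?q w"
    by (auto simp: longest_common_prefix_prefix1 longest_common_prefix_prefix2)
  have c: "c \<le> length ?p" "c \<le> length ?q"
    using False assms by (auto simp: lcp_def)
  have "\<exists>r. prefix r u \<and> prefix r w \<and> c \<le> length r"
    using prefix_same_cases[OF p(2) q(1)] p q c by (meson prefix_order.trans)
  then obtain r where r: "prefix r u" "prefix r w" "c \<le> length r" by blast
  then have "length r \<le> length (longest_common_prefix u w)"
    using longest_common_prefix_max_prefix prefix_length_le by blast
  then show ?thesis using r False by (auto simp: lcp_def)
qed

lemma lcp_commute: "lcp u v = lcp v u"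
proof -
  have "longest_common_prefix u v = longest_common_prefix v u"
    by (simp add: prefix_order.antisym longest_common_prefix_max_prefix
        longest_common_prefix_prefix1 longest_common_prefix_prefix2)
  then show ?thesis by (auto simp: lcp_def)
qed

lemma lcs_trans: "ereal c \<le> lcs u v \<Longrightarrow> ereal c \<le> lcs v w \<Longrightarrow> ereal c \<le> lcs u w"
  unfolding lcs_def by (rule lcp_trans)

lemma lcs_commute: "lcs u v = lcs v u"
  unfolding lcs_def by (rule lcp_commute)

lemma equiv_word_equiv:
  "equiv moderate_words (word_equiv :: ((real \<Rightarrow> 'a::finite list) \<times> (real \<Rightarrow> 'a list)) set)"
    (is "equiv _ ?R")
proof (rule equivI)
  show "?R \<subseteq> moderate_words \<times> moderate_words" by (auto simp: word_equiv_def)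
  show "refl_on moderate_words ?R"
    by (auto simp: refl_on_def word_equiv_def lcp_def lcs_def)
  show "sym ?R"
    by (auto simp: sym_def word_equiv_def lcp_commute lcs_commute)
  show "trans ?R"
  proof (rule transI)
    fix u v w :: "real \<Rightarrow> 'a list"
    assume uv: "(u, v) \<in> word_equiv" and vw: "(v, w) \<in> word_equiv"
    have "\<forall>\<^sub>F \<epsilon> in at_right 0.
        min (lcp (u \<epsilon>) (w \<epsilon>)) (lcs (u \<epsilon>) (w \<epsilon>)) \<ge> ereal (real m * log 2 (1 / \<epsilon>))" for m :: nat
    proof -
      have "\<forall>\<^sub>F \<epsilon> in at_right 0.
          min (lcp (u \<epsilon>) (v \<epsilon>)) (lcs (u \<epsilon>) (v \<epsilon>)) \<ge> ereal (real m * log 2 (1 / \<epsilon>))"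
        "\<forall>\<^sub>F \<epsilon> in at_right 0.
          min (lcp (v \<epsilon>) (w \<epsilon>)) (lcs (v \<epsilon>) (w \<epsilon>)) \<ge> ereal (real m * log 2 (1 / \<epsilon>))"
        using uv vw by (auto simp only: word_equiv_def mem_Collect_eq prod.case)
      then show ?thesis
        by eventually_elim (metis lcp_trans lcs_trans min.bounded_iff)
    qed
    then show "(u, w) \<in> word_equiv" using uv vw by (simp add: word_equiv_def)
  qed
qed

lemma equiv_complex_equiv: "equiv moderate_complex complex_equiv"
proof -
  have mem: "(\<lambda>\<epsilon>\<in>{0<..1}. z \<epsilon> - z' \<epsilon>) \<in> negligible_complex \<longleftrightarrow>
      (\<forall>m::nat. \<exists>C>0. \<forall>\<^sub>F \<epsilon> in at_right 0. cmod (z \<epsilon> - z' \<epsilon>) \<le> C * \<epsilon> ^ m)" for z z'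
  proof -
    have ev: "\<forall>\<^sub>F \<epsilon>::real in at_right 0. \<epsilon> \<in> {0<..1}"
      by (auto simp: eventually_at_right_field intro!: exI[of _ 1])
    have "(\<forall>\<^sub>F \<epsilon> in at_right 0. cmod ((\<lambda>\<epsilon>\<in>{0<..1}. z \<epsilon> - z' \<epsilon>) \<epsilon>) \<le> C * \<epsilon> ^ m) \<longleftrightarrow>
          (\<forall>\<^sub>F \<epsilon> in at_right 0. cmod (z \<epsilon> - z' \<epsilon>) \<le> C * \<epsilon> ^ m)" for C and m :: nat
      by (rule eventually_cong[OF ev]) simp
    then show ?thesis by (simp add: negligible_complex_def)
  qed
  show ?thesis
  proof (rule equivI)
    show "complex_equiv \<subseteq> moderate_complex \<times> moderate_complex" by (auto simp: complex_equiv_def)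
    show "refl_on moderate_complex complex_equiv"
    proof (rule refl_onI)
      fix z assume "z \<in> moderate_complex"
      moreover have "\<forall>\<^sub>F \<epsilon>::real in at_right 0. 0 \<le> 1 * \<epsilon> ^ m" for m :: nat
        by (auto simp: eventually_at_right_field intro!: exI[of _ 1])
      ultimately show "(z, z) \<in> complex_equiv"
        unfolding complex_equiv_def mem_Collect_eq prod.case mem
        by (auto intro!: exI[of _ 1])
    qed
    show "sym complex_equiv"
      unfolding sym_def complex_equiv_def mem_Collect_eq prod.case mem
      by (auto simp: norm_minus_commute)
    show "trans complex_equiv"
    proof (rule transI)
      fix x y z assume xy: "(x, y) \<in> complex_equiv" and yz: "(y, z) \<in> complex_equiv"
      have "\<exists>C>0. \<forall>\<^sub>F \<epsilon> in at_right 0. cmod (x \<epsilon> - z \<epsilon>) \<le> C * \<epsilon> ^ m" for m :: nat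
      proof -
        obtain C D where "C > 0" "D > 0"
          and C: "\<forall>\<^sub>F \<epsilon> in at_right 0. cmod (x \<epsilon> - y \<epsilon>) \<le> C * \<epsilon> ^ m"
          and D: "\<forall>\<^sub>F \<epsilon> in at_right 0. cmod (y \<epsilon> - z \<epsilon>) \<le> D * \<epsilon> ^ m"
          using xy yz unfolding complex_equiv_def mem_Collect_eq prod.case mem by blast
        have "\<forall>\<^sub>F \<epsilon> in at_right 0. cmod (x \<epsilon> - z \<epsilon>) \<le> (C + D) * \<epsilon> ^ m"
          using C D
        proof eventually_elim
          case (elim \<epsilon>)
          then show ?case
            using norm_triangle_ineq[of "x \<epsilon> - y \<epsilon>" "y \<epsilon> - z \<epsilon>"] by (simp add: distrib_right)
        qed
        then show ?thesis using \<open>C > 0\<close> \<open>D > 0\<close> by (intro exI[of _ "C + D"]) auto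
      qed
      then show "(x, z) \<in> complex_equiv"
        using xy yz unfolding complex_equiv_def mem_Collect_eq prod.case mem by blast
    qed
  qed
qed

end

theory Submission
  imports Defs "HOL-Real_Asymp.Real_Asymp"
begin

text \<open>
  Equivalent nets of words agree, for every \<open>m\<close> and all small \<open>\<epsilon>\<close>, on their first
  \<open>m log\<^sub>2 (1/\<epsilon>)\<close> letters. A functional that reads only logarithmically many letters
  therefore takes the \<^emph>\<open>same\<close> value on equivalent nets for all small \<open>\<epsilon>\<close>, so its values
  differ by a negligible net (\<open>apply_net_equiv_of_log_bounded_window\<close>).

  Conversely, let the window grow faster than every multiple of \<open>log\<^sub>2 (1/\<epsilon>)\<close>. Then there is a
  threshold \<open>K \<epsilon> \<le> L \<epsilon>\<close> that still outgrows every such multiple but is at most \<open>1/\<epsilon>\<close>. The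
  functional that tests whether a word has at least \<open>K \<epsilon>\<close> letters is visible in the window and
  bounded by \<open>1\<close>. It separates the words \<open>a\<^bsup>K\<^esup>\<close> and \<open>a\<^bsup>K-1\<^esup>\<close> by a
  difference of \<open>1\<close>, although these words form moderate nets and have a common prefix and a
  common suffix of length \<open>K - 1\<close>, so they represent the same generalized word
  (\<open>replicate_threshold_equiv\<close>). The construction uses a single letter, hence it works over every
  alphabet.

  Both parts refer to the same criterion: a functional that preserves moderateness descends to
  the quotient exactly when it maps equivalent nets to equal classes
  (\<open>well_defined_on_gen_words_iff\<close>).
\<close>

section \<open>Common prefixes\<close>

lemma length_le_lcp:
  assumes "prefix p u" "prefix p v"
  shows "ereal (real (length p)) \<le> lcp u v"
  using prefix_length_le[OF longest_common_prefix_max_prefix[OF assms]]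
  by (simp add: lcp_def)

lemma take_eq_of_le_lcp:
  assumes "ereal (real n) \<le> lcp u v"
  shows "take n u = take n v"
proof (cases "u = v")
  case False
  define p where "p = longest_common_prefix u v"
  have "n \<le> length p" using assms False by (simp add: lcp_def p_def)
  moreover have "prefix p u" "prefix p v"
    by (auto simp: p_def longest_common_prefix_prefix1 longest_common_prefix_prefix2)
  ultimately show ?thesis by (auto simp: prefix_def)
qed simp

section \<open>Generalized words and generalized complex numbers\<close>

lemma eventually_index: "\<forall>\<^sub>F \<epsilon>::real in at_right 0. \<epsilon> \<in> {0<..<1}"
  by (rule eventually_at_right_real) simp

lemma restrict_in_nets: "restrict f {0<..1} \<in> nets"
  by simp

lemma word_class_eq_iff:
  assumes "u \<in> moderate_words" "v \<in> moderate_words"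
  shows "word_class u = word_class v \<longleftrightarrow> (u, v) \<in> word_equiv"
  unfolding word_class_def using eq_equiv_class_iff[OF equiv_word_equiv assms] .

lemma complex_class_eq_iff:
  assumes "z \<in> moderate_complex" "z' \<in> moderate_complex"
  shows "complex_class z = complex_class z' \<longleftrightarrow> (z, z') \<in> complex_equiv"
  unfolding complex_class_def using eq_equiv_class_iff[OF equiv_complex_equiv assms] .

lemma well_defined_on_gen_words_iff:
  assumes "preserves_moderate F"
  shows "well_defined_on_gen_words F \<longleftrightarrow>
    (\<forall>(u, v)\<in>word_equiv. complex_class (apply_net F u) = complex_class (apply_net F v))"
proof
  assume "well_defined_on_gen_words F"
  then obtain \<Phi> where \<Phi>: "\<And>w. w \<in> moderate_words \<Longrightarrow> \<Phi> (word_class w) = complex_class (apply_net F w)"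
    unfolding well_defined_on_gen_words_def by blast
  show "\<forall>(u, v)\<in>word_equiv. complex_class (apply_net F u) = complex_class (apply_net F v)"
  proof clarify
    fix u v :: "real \<Rightarrow> 'a list" assume uv: "(u, v) \<in> word_equiv"
    then have "u \<in> moderate_words" "v \<in> moderate_words" by (auto simp: word_equiv_def)
    then show "complex_class (apply_net F u) = complex_class (apply_net F v)"
      using \<Phi> uv word_class_eq_iff by metis
  qed
next
  assume R: "\<forall>(u, v)\<in>word_equiv. complex_class (apply_net F u) = complex_class (apply_net F v)"
  define \<Phi> where "\<Phi> W = complex_class (apply_net F (SOME w. w \<in> W))" for W
  have \<Phi>: "\<Phi> (word_class w) = complex_class (apply_net F w)" if "w \<in> moderate_words" for w
  proof -
    have "w \<in> word_class w"
      unfolding word_class_def by (rule equiv_class_self[OF equiv_word_equiv that])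
    then have "(w, SOME w'. w' \<in> word_class w) \<in> word_equiv"
      using someI[of "\<lambda>w'. w' \<in> word_class w"] by (auto simp: word_class_def)
    then show ?thesis using R unfolding \<Phi>_def by fastforce
  qed
  have "\<Phi> W \<in> gen_complex" if W: "W \<in> gen_words" for W
  proof -
    obtain w where "w \<in> moderate_words" "W = word_class w"
      using W unfolding gen_words_def word_class_def by (auto elim: quotientE)
    then show ?thesis
      using \<Phi> assms unfolding preserves_moderate_def gen_complex_def
      by (auto simp: complex_class_def intro: quotientI)
  qed
  then show "well_defined_on_gen_words F"
    unfolding well_defined_on_gen_words_def using \<Phi> by blast
qed

lemma complex_equiv_of_eventually_eq:
  assumes "z \<in> moderate_complex" "z' \<in> moderate_complex"
    and eq: "\<forall>\<^sub>F \<epsilon> in at_right 0. z \<epsilon> = z' \<epsilon>"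
  shows "(z, z') \<in> complex_equiv"
proof -
  have "\<forall>\<^sub>F \<epsilon> in at_right 0. cmod ((\<lambda>\<epsilon>\<in>{0<..1}. z \<epsilon> - z' \<epsilon>) \<epsilon>) \<le> 1 * \<epsilon> ^ m" for m
    using eq eventually_index by eventually_elim auto
  then have "(\<lambda>\<epsilon>\<in>{0<..1}. z \<epsilon> - z' \<epsilon>) \<in> negligible_complex"
    unfolding negligible_complex_def
    by (intro CollectI conjI allI restrict_in_nets exI[of _ "1::real"] zero_less_one)
  then show ?thesis using assms by (simp add: complex_equiv_def)
qed

text \<open>
  Testing negligibility against the first power \<open>\<epsilon>\<^sup>1\<close> suffices: since \<open>C * \<epsilon> \<rightarrow> 0\<close>, a
  negligible difference cannot keep absolute value \<open>1\<close>.
\<close>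

lemma not_complex_equiv_of_eventually_dist_1:
  assumes dist: "\<forall>\<^sub>F \<epsilon> in at_right 0. cmod (z \<epsilon> - z' \<epsilon>) = 1"
  shows "(z, z') \<notin> complex_equiv"
proof
  assume "(z, z') \<in> complex_equiv"
  then obtain C where
    C: "\<forall>\<^sub>F \<epsilon> in at_right 0. cmod ((\<lambda>\<epsilon>\<in>{0<..1}. z \<epsilon> - z' \<epsilon>) \<epsilon>) \<le> C * \<epsilon> ^ 1"
    by (auto simp only: complex_equiv_def negligible_complex_def mem_Collect_eq prod.case)
  have "((\<lambda>\<epsilon>. C * \<epsilon>) \<longlongrightarrow> C * 0) (at_right 0)"
    by (intro tendsto_intros)
  then have "\<forall>\<^sub>F \<epsilon> in at_right 0. C * \<epsilon> < 1"
    by (rule order_tendstoD) simp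
  with C dist eventually_index have "\<forall>\<^sub>F \<epsilon>::real in at_right 0. False"
    by eventually_elim auto
  then show False by simp
qed

section \<open>Windows of logarithmic length\<close>

text \<open>
  The exponent \<open>m\<close> that bounds the window is the one at which to use the equivalence of \<open>u\<close> and \<open>v\<close>:
  it makes the two nets agree on the whole window for small \<open>\<epsilon>\<close>, so the values are eventually equal.
\<close>

lemma apply_net_equiv_of_log_bounded_window:
  fixes F :: "real \<Rightarrow> 'a::finite list \<Rightarrow> complex"
  assumes window: "depends_on_window F L" and "preserves_moderate F"
    and L: "\<forall>\<^sub>F \<epsilon> in at_right 0. real (L \<epsilon>) \<le> real m * log 2 (1 / \<epsilon>)"
    and uv: "(u, v) \<in> word_equiv"
  shows "(apply_net F u, apply_net F v) \<in> complex_equiv"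
proof (rule complex_equiv_of_eventually_eq)
  show "apply_net F u \<in> moderate_complex" "apply_net F v \<in> moderate_complex"
    using assms by (auto simp: preserves_moderate_def word_equiv_def)
  have "\<forall>\<^sub>F \<epsilon> in at_right 0.
      min (lcp (u \<epsilon>) (v \<epsilon>)) (lcs (u \<epsilon>) (v \<epsilon>)) \<ge> ereal (real m * log 2 (1 / \<epsilon>))"
    using uv by (auto simp only: word_equiv_def mem_Collect_eq prod.case)
  then show "\<forall>\<^sub>F \<epsilon> in at_right 0. apply_net F u \<epsilon> = apply_net F v \<epsilon>"
    using L eventually_index
  proof eventually_elim
    case (elim \<epsilon>)
    have "ereal (real (L \<epsilon>)) \<le> ereal (real m * log 2 (1 / \<epsilon>))"
      using elim(2) by simp
    also have "\<dots> \<le> lcp (u \<epsilon>) (v \<epsilon>)"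
      using elim(1) by simp
    finally have "take (L \<epsilon>) (u \<epsilon>) = take (L \<epsilon>) (v \<epsilon>)"
      by (rule take_eq_of_le_lcp)
    then have "F \<epsilon> (u \<epsilon>) = F \<epsilon> (v \<epsilon>)"
      using window elim(3) unfolding depends_on_window_def greaterThanLessThan_iff
        greaterThanAtMost_iff Ball_def by (meson less_imp_le)
    then show ?case by (simp add: apply_net_def)
  qed
qed

lemma log_window_le: "\<epsilon> \<in> {0<..<1} \<Longrightarrow> real (log_window \<epsilon>) \<le> log 2 (1 / \<epsilon>)"
  unfolding log_window_def by (intro of_nat_floor) simp

section \<open>Windows of superlogarithmic length\<close>

text \<open>
  Cutting off at \<open>1/\<epsilon>\<close> keeps words of this length moderate even when the window is
  longer than every power of \<open>1/\<epsilon>\<close>.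
\<close>

definition threshold :: "(real \<Rightarrow> nat) \<Rightarrow> real \<Rightarrow> nat" where
  "threshold L \<epsilon> = min (L \<epsilon>) (nat \<lfloor>1 / \<epsilon>\<rfloor>)"

text \<open>
  The extra \<open>+ 1\<close> leaves room for removing one letter: words of length \<open>threshold L \<epsilon> - 1\<close>
  have at least \<open>m log\<^sub>2 (1/\<epsilon>)\<close> letters.
\<close>

lemma threshold_superlogarithmic:
  assumes L: "filterlim (\<lambda>\<epsilon>. real (L \<epsilon>) / log 2 (1 / \<epsilon>)) at_top (at_right 0)"
  shows "\<forall>\<^sub>F \<epsilon> in at_right 0. real m * log 2 (1 / \<epsilon>) + 1 \<le> real (threshold L \<epsilon>)"
proof -
  have "\<forall>\<^sub>F \<epsilon> in at_right 0. real m + 1 \<le> real (L \<epsilon>) / log 2 (1 / \<epsilon>)"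
    using L by (auto simp: filterlim_at_top)
  moreover have "\<forall>\<^sub>F \<epsilon>::real in at_right 0. 1 \<le> log 2 (1 / \<epsilon>)"
    by real_asymp
  \<comment> \<open>The second unit pays for rounding \<open>1/\<epsilon>\<close> down to a natural number.\<close>
  moreover have "\<forall>\<^sub>F \<epsilon>::real in at_right 0. real m * log 2 (1 / \<epsilon>) + 2 \<le> 1 / \<epsilon>"
    by real_asymp
  ultimately show ?thesis
    using eventually_index
  proof eventually_elim
    case (elim \<epsilon>)
    have "(real m + 1) * log 2 (1 / \<epsilon>) \<le> real (L \<epsilon>)"
      using elim(1,2) by (simp add: pos_le_divide_eq)
    then have "real m * log 2 (1 / \<epsilon>) + 1 \<le> real (L \<epsilon>)"
      using elim(2) by (simp add: distrib_right)
    moreover have "real m * log 2 (1 / \<epsilon>) + 1 \<le> real (nat \<lfloor>1 / \<epsilon>\<rfloor>)"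
      using elim(3) by linarith
    ultimately show ?case by (simp add: threshold_def)
  qed
qed

lemma moderate_words_of_length_le:
  fixes w :: "real \<Rightarrow> 'a::finite list"
  assumes "\<And>\<epsilon>. \<epsilon> \<in> {0<..<1} \<Longrightarrow> real (length (w \<epsilon>)) \<le> 1 / \<epsilon>"
  shows "restrict w {0<..1} \<in> moderate_words"
proof -
  have "\<forall>\<^sub>F \<epsilon> in at_right 0.
      real (length (restrict w {0<..1} \<epsilon>)) \<le> 1 * \<epsilon> powr (- real 1)"
    using eventually_index
  proof eventually_elim
    case (elim \<epsilon>)
    then show ?case using assms[OF elim] by (simp add: powr_minus_divide)
  qed
  then show ?thesis
    unfolding moderate_words_def
    by (intro CollectI conjI restrict_in_nets exI[of _ "1::nat"] exI[of _ "1::real"] zero_less_one)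
qed

lemma replicate_threshold_equiv:
  fixes a :: "'a::finite"
  assumes L: "filterlim (\<lambda>\<epsilon>. real (L \<epsilon>) / log 2 (1 / \<epsilon>)) at_top (at_right 0)"
  shows "(\<lambda>\<epsilon>\<in>{0<..1}. replicate (threshold L \<epsilon>) a,
          \<lambda>\<epsilon>\<in>{0<..1}. replicate (threshold L \<epsilon> - 1) a) \<in> word_equiv"
    (is "(?u, ?v) \<in> _")
proof -
  have bound: "real (threshold L \<epsilon>) \<le> 1 / \<epsilon>" if "\<epsilon> \<in> {0<..<1}" for \<epsilon>
  proof -
    have "real (threshold L \<epsilon>) \<le> real (nat \<lfloor>1 / \<epsilon>\<rfloor>)"
      by (simp add: threshold_def)
    also have "\<dots> \<le> 1 / \<epsilon>"
      using that by (intro of_nat_floor) simp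
    finally show ?thesis .
  qed
  have "?u \<in> moderate_words"
    by (rule moderate_words_of_length_le) (use bound in simp)
  moreover have "?v \<in> moderate_words"
  proof (rule moderate_words_of_length_le)
    fix \<epsilon> :: real assume "\<epsilon> \<in> {0<..<1}"
    then show "real (length (replicate (threshold L \<epsilon> - 1) a)) \<le> 1 / \<epsilon>"
      using bound[of \<epsilon>] by simp
  qed
  moreover have "\<forall>\<^sub>F \<epsilon> in at_right 0.
      min (lcp (?u \<epsilon>) (?v \<epsilon>)) (lcs (?u \<epsilon>) (?v \<epsilon>)) \<ge> ereal (real m * log 2 (1 / \<epsilon>))" for m
    using threshold_superlogarithmic[OF L, of m] eventually_index
  proof eventually_elim
    case (elim \<epsilon>)
    let ?k = "threshold L \<epsilon>"
    have "prefix (replicate (?k - 1) a) (replicate ?k a)"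
      by (metis diff_le_self le_add_diff_inverse prefixI replicate_add)
    then have "ereal (real (?k - 1)) \<le> lcp (replicate ?k a) (replicate (?k - 1) a)"
      using length_le_lcp[of "replicate (?k - 1) a"] by fastforce
    moreover have "ereal (real m * log 2 (1 / \<epsilon>)) \<le> ereal (real (?k - 1))"
      using elim(1) by simp
    ultimately have "ereal (real m * log 2 (1 / \<epsilon>)) \<le> lcp (replicate ?k a) (replicate (?k - 1) a)"
      by (rule order_trans[rotated])
    \<comment> \<open>Powers of a single letter are palindromes, so the suffix bound is the prefix bound.\<close>
    then show ?case using elim(2) by (simp add: lcs_def)
  qed
  ultimately show ?thesis by (simp add: word_equiv_def)
qed

definition reaches_threshold :: "(real \<Rightarrow> nat) \<Rightarrow> real \<Rightarrow> 'a list \<Rightarrow> complex" where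
  "reaches_threshold L \<epsilon> w = of_bool (threshold L \<epsilon> \<le> length w)"

text \<open>The threshold lies inside the window, so truncation to the window cannot hide it.\<close>

lemma depends_on_window_reaches_threshold: "depends_on_window (reaches_threshold L) L"
  unfolding depends_on_window_def
proof clarify
  fix \<epsilon> :: real and u v :: "'a list"
  assume "take (L \<epsilon>) u = take (L \<epsilon>) v"
  then have "min (length u) (L \<epsilon>) = min (length v) (L \<epsilon>)"
    by (metis length_take)
  moreover have "threshold L \<epsilon> \<le> L \<epsilon>"
    by (simp add: threshold_def)
  ultimately have "threshold L \<epsilon> \<le> length u \<longleftrightarrow> threshold L \<epsilon> \<le> length v"
    by linarith
  then show "reaches_threshold L \<epsilon> u = reaches_threshold L \<epsilon> v"
    by (simp add: reaches_threshold_def)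
qed

lemma preserves_moderate_of_bounded:
  fixes F :: "real \<Rightarrow> 'a::finite list \<Rightarrow> complex"
  assumes "\<And>\<epsilon> w. cmod (F \<epsilon> w) \<le> 1"
  shows "preserves_moderate F"
  unfolding preserves_moderate_def
proof
  fix w :: "real \<Rightarrow> 'a list"
  have "\<forall>\<^sub>F \<epsilon> in at_right 0. cmod (apply_net F w \<epsilon>) \<le> 1 * \<epsilon> powr (- real 1)"
    using eventually_index
  proof eventually_elim
    case (elim \<epsilon>)
    have "cmod (F \<epsilon> (w \<epsilon>)) \<le> 1" by (rule assms)
    also have "1 \<le> 1 / \<epsilon>" using elim by simp
    finally show ?case using elim by (simp add: apply_net_def powr_minus_divide)
  qed
  then show "apply_net F w \<in> moderate_complex"
    unfolding moderate_complex_def apply_net_def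
    by (intro CollectI conjI restrict_in_nets exI[of _ "1::nat"] exI[of _ "1::real"] zero_less_one)
qed

section \<open>Well-definedness on generalized words\<close>

theorem proposition3p6:
  shows "(\<forall>F :: real \<Rightarrow> 'a::finite list \<Rightarrow> complex.
            depends_on_window F log_window \<and> preserves_moderate F \<longrightarrow>
            well_defined_on_gen_words F)
       \<and> (\<forall>L :: real \<Rightarrow> nat.
            filterlim (\<lambda>\<epsilon>. real (L \<epsilon>) / log 2 (1 / \<epsilon>)) at_top (at_right 0) \<longrightarrow>
            (\<exists>F :: real \<Rightarrow> 'a list \<Rightarrow> complex.
               depends_on_window F L \<and> preserves_moderate F \<and>
               \<not> well_defined_on_gen_words F \<and>
               (\<exists>W\<in>gen_words. \<exists>u\<in>W. \<exists>v\<in>W.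
                  complex_class (apply_net F u) \<noteq> complex_class (apply_net F v))))"
proof (intro conjI allI impI)
  fix F :: "real \<Rightarrow> 'a list \<Rightarrow> complex"
  assume "depends_on_window F log_window \<and> preserves_moderate F"
  then have F: "depends_on_window F log_window" "preserves_moderate F" by auto
  have "\<forall>\<^sub>F \<epsilon> in at_right 0. real (log_window \<epsilon>) \<le> real 1 * log 2 (1 / \<epsilon>)"
    using eventually_index by eventually_elim (use log_window_le in simp)
  then have "complex_class (apply_net F u) = complex_class (apply_net F v)"
    if "(u, v) \<in> word_equiv" for u v
    unfolding complex_class_def
    by (rule equiv_class_eq[OF equiv_complex_equiv
          apply_net_equiv_of_log_bounded_window[OF F _ that]])
  then show "well_defined_on_gen_words F"
    unfolding well_defined_on_gen_words_iff[OF F(2)] by auto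
next
  fix L :: "real \<Rightarrow> nat"
  assume L: "filterlim (\<lambda>\<epsilon>. real (L \<epsilon>) / log 2 (1 / \<epsilon>)) at_top (at_right 0)"
  define F :: "real \<Rightarrow> 'a list \<Rightarrow> complex" where "F = reaches_threshold L"
  define a :: 'a where "a = undefined"
  define u where "u = (\<lambda>\<epsilon>\<in>{0<..1}. replicate (threshold L \<epsilon>) a)"
  define v where "v = (\<lambda>\<epsilon>\<in>{0<..1}. replicate (threshold L \<epsilon> - 1) a)"
  have F: "depends_on_window F L" "preserves_moderate F"
    unfolding F_def by (rule depends_on_window_reaches_threshold,
        rule preserves_moderate_of_bounded, simp add: reaches_threshold_def)
  have uv: "(u, v) \<in> word_equiv"
    unfolding u_def v_def using L by (rule replicate_threshold_equiv)
  then have mod: "u \<in> moderate_words" "v \<in> moderate_words"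
    by (auto simp: word_equiv_def)
  \<comment> \<open>At indices with threshold \<open>0\<close> the words \<open>u \<epsilon>\<close> and \<open>v \<epsilon>\<close> coincide; the case \<open>m = 0\<close> of
    superlogarithmic growth rules this out for small \<open>\<epsilon>\<close>.\<close>
  have "\<forall>\<^sub>F \<epsilon> in at_right 0. cmod (apply_net F u \<epsilon> - apply_net F v \<epsilon>) = 1"
    using threshold_superlogarithmic[OF L, of 0] eventually_index
    by eventually_elim (auto simp: apply_net_def F_def reaches_threshold_def u_def v_def)
  then have "(apply_net F u, apply_net F v) \<notin> complex_equiv"
    by (rule not_complex_equiv_of_eventually_dist_1)
  then have ne: "complex_class (apply_net F u) \<noteq> complex_class (apply_net F v)"
    using complex_class_eq_iff[of "apply_net F u" "apply_net F v"] F(2) mod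
    unfolding preserves_moderate_def by blast
  have "\<not> well_defined_on_gen_words F"
    using well_defined_on_gen_words_iff[OF F(2)] uv ne by blast
  moreover have "word_class u \<in> gen_words" "u \<in> word_class u" "v \<in> word_class u"
    using mod uv equiv_class_self[OF equiv_word_equiv mod(1)]
    by (auto simp: word_class_def gen_words_def intro: quotientI)
  ultimately show "\<exists>F :: real \<Rightarrow> 'a list \<Rightarrow> complex.
      depends_on_window F L \<and> preserves_moderate F \<and> \<not> well_defined_on_gen_words F \<and>
      (\<exists>W\<in>gen_words. \<exists>u\<in>W. \<exists>v\<in>W.
         complex_class (apply_net F u) \<noteq> complex_class (apply_net F v))"
    using F ne by (intro exI[of _ F] conjI bexI[of _ "word_class u"] bexI[of _ u] bexI[of _ v])
qed

end
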